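(* For every $n\ge0$ and $0\le p\le n$, with $S_n=F_nU_n^{-1}$, $$S_n^{-1}x^p=\frac{p!\,(n-p)!}{(2n)!}\sum_{m=p}^{n}\binom{-n}{m-p}\binom{2n}{n-m}x^m .$$
   Context: Polynomials over $\mathbb{C}$; $\binom{y}{k}=y(y-1)\cdots(y-k+1)/k!$ for $k\ge0$. $(y)_p=y(y-1)\cdots(y-p+1)$, $[y]_k=y(y+1)\cdots(y+k-1)$. On polynomials of degree at most $n$: $U_nx^p=\frac{(1-x)^{n+1}}{n!}\sum_{m\ge0}m^px^m$ ($0^0=1$), with inverse $U_n^{-1}x^p=(x)_p[x+1]_{n-p}$; $F_nx^p=(1-x)^{2n+1}\sum_{m\ge0}m^p\binom{m+n}{n}x^m$, with inverse $F_n^{-1}x^p=\frac{n!}{(2n)!}(x)_p[x+n+1]_{n-p}$. Thus $S_n^{-1}=U_nF_n^{-1}$. *)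

theory Defs
  imports "HOL-Computational_Algebra.Computational_Algebra"
begin

definition polys :: "nat \<Rightarrow> complex poly set" where
  "polys n = {f. degree f \<le> n}"

text \<open>
  The series defining \<open>U\<^sub>n x\<^sup>p\<close> and \<open>F\<^sub>n x\<^sup>p\<close> are read as formal power series; for \<open>p \<le> n\<close> they are
  polynomials (lemmas \<open>U_mono\<close> and \<open>F_mono\<close> below), so \<open>THE\<close> is well-defined there.
  Since \<open>0 ^ 0 = 1\<close> in HOL, the coefficient of \<open>x\<^sup>0\<close> for \<open>p = 0\<close> is as intended.
  Both operators are extended linearly and are meaningful on \<^term>\<open>polys n\<close> only.
\<close>

definition U_series :: "nat \<Rightarrow> nat \<Rightarrow> complex fps" where
  "U_series n p =
     fps_const (1 / fact n) * (1 - fps_X) ^ (n + 1) * Abs_fps (\<lambda>m. of_nat m ^ p)"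

definition F_series :: "nat \<Rightarrow> nat \<Rightarrow> complex fps" where
  "F_series n p =
     (1 - fps_X) ^ (2 * n + 1) * Abs_fps (\<lambda>m. of_nat m ^ p * of_nat ((m + n) choose n))"

definition U_mono :: "nat \<Rightarrow> nat \<Rightarrow> complex poly" where
  "U_mono n p = (THE q. fps_of_poly q = U_series n p)"

definition F_mono :: "nat \<Rightarrow> nat \<Rightarrow> complex poly" where
  "F_mono n p = (THE q. fps_of_poly q = F_series n p)"

definition U_op :: "nat \<Rightarrow> complex poly \<Rightarrow> complex poly" where
  "U_op n f = (\<Sum>p\<le>n. smult (coeff f p) (U_mono n p))"

definition F_op :: "nat \<Rightarrow> complex poly \<Rightarrow> complex poly" where
  "F_op n f = (\<Sum>p\<le>n. smult (coeff f p) (F_mono n p))"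

text \<open>
  Inverses are taken on \<^term>\<open>polys n\<close>, where the three operators are bijective
  (lemmas \<open>bij_betw_U_op\<close>, \<open>bij_betw_F_op\<close>, \<open>bij_betw_S_op\<close>).
\<close>

definition U_inv :: "nat \<Rightarrow> complex poly \<Rightarrow> complex poly" where
  "U_inv n = the_inv_into (polys n) (U_op n)"

definition S_op :: "nat \<Rightarrow> complex poly \<Rightarrow> complex poly" where
  "S_op n = F_op n \<circ> U_inv n"

definition S_inv :: "nat \<Rightarrow> complex poly \<Rightarrow> complex poly" where
  "S_inv n = the_inv_into (polys n) (S_op n)"


subsection \<open>The operators are well-defined and bijective\<close>

text \<open>
  The polynomial \<open>(x)\<^sub>p [x + c]\<^bsub>n-p\<^esub>\<close>. The cases \<open>c = 1\<close> and \<open>c = n + 1\<close> give the explicit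
  inverses of \<open>U\<^sub>n\<close> and, up to the factor \<open>n! / (2n)!\<close>, of \<open>F\<^sub>n\<close>
  (lemmas \<open>U_op_fpoly\<close> and \<open>F_op_fpoly\<close>).
\<close>

definition fpoly :: "nat \<Rightarrow> nat \<Rightarrow> nat \<Rightarrow> complex poly" where
  "fpoly c n p = (\<Prod>i<p. [:- of_nat i, 1:]) * (\<Prod>i<n - p. [:of_nat (c + i), 1:])"

lemma degree_fpoly: "p \<le> n \<Longrightarrow> degree (fpoly c n p) \<le> n"
proof -
  assume "p \<le> n"
  have "degree (\<Prod>i<p. [:- of_nat i, 1:] :: complex poly) = p"
    by (subst degree_prod_eq_sum_degree) auto
  moreover have "degree (\<Prod>i<n-p. [:of_nat (c + i), 1:] :: complex poly) = n - p"
    by (subst degree_prod_eq_sum_degree) auto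
  ultimately show ?thesis
    using degree_mult_le[of "\<Prod>i<p. [:- of_nat i, 1:] :: complex poly"
        "\<Prod>i<n-p. [:of_nat (c + i), 1:]"] \<open>p \<le> n\<close>
    unfolding fpoly_def by simp
qed

lemma falling_of_nat:
  "(\<Prod>i<p. (of_nat m - of_nat i :: complex)) = (if m < p then 0 else fact m / fact (m - p))"
proof (induction p)
  case (Suc p)
  show ?case
  proof (cases "m < Suc p")
    case True
    then show ?thesis by (auto simp: prod_zero_iff intro!: bexI[of _ m])
  next
    case False
    then have "m - p = Suc (m - Suc p)" by simp
    then have "fact (m - p) = (of_nat (m - p) :: complex) * fact (m - Suc p)"
      by (metis fact_Suc)
    then show ?thesis using Suc False by (simp add: of_nat_diff)
  qed
qed simp

lemma rising_of_nat:
  assumes "c \<ge> 1"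
  shows "(\<Prod>i<k. (of_nat (c + i) + of_nat m :: complex)) = fact (m + c + k - 1) / fact (m + c - 1)"
proof (induction k)
  case (Suc k)
  have "m + c + Suc k - 1 = Suc (m + c + k - 1)" using assms by simp
  then have "fact (m + c + Suc k - 1) = (of_nat (c + k + m) :: complex) * fact (m + c + k - 1)"
    using assms by (metis (no_types, lifting) add.commute add.left_commute add_Suc_right diff_Suc_1 fact_Suc)
  then show ?case using Suc by simp
qed simp

lemma poly_fpoly:
  assumes "c \<ge> 1"
  shows "poly (fpoly c n p) (of_nat m) =
    (if m < p then 0 else fact m / fact (m - p) * (fact (m + c + (n - p) - 1) / fact (m + c - 1)))"
proof -
  have "poly (fpoly c n p) (of_nat m) =
      (\<Prod>i<p. (of_nat m - of_nat i :: complex)) * (\<Prod>i<n - p. (of_nat (c + i) + of_nat m))"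
    unfolding fpoly_def by (simp add: poly_prod)
  then show ?thesis unfolding falling_of_nat rising_of_nat[OF assms] by simp
qed

lemma polys_eqI:
  assumes "f \<in> polys n" "g \<in> polys n" "\<And>j. j \<le> n \<Longrightarrow> poly f (of_nat j) = poly g (of_nat j)"
  shows "f = g"
proof (rule poly_eqI_degree[where A = "of_nat ` {..n}"])
  have "card (of_nat ` {..n} :: complex set) = Suc n"
    by (subst card_image) (auto simp: inj_on_def)
  then show "degree f < card (of_nat ` {..n} :: complex set)"
    "degree g < card (of_nat ` {..n} :: complex set)"
    using assms(1,2) by (auto simp: polys_def)
qed (use assms(3) in auto)

lemma fpoly_span:
  assumes c: "c \<ge> 1" and f: "f \<in> polys n"
  shows "\<exists>a. f = (\<Sum>p\<le>n. smult (a p) (fpoly c n p))"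
proof -
  have "\<exists>a. \<forall>j<k. poly (\<Sum>p<k. smult (a p) (fpoly c n p)) (of_nat j) = poly f (of_nat j)" for k
  proof (induction k)
    case (Suc k)
    then obtain a where a:
      "\<And>j. j < k \<Longrightarrow> poly (\<Sum>p<k. smult (a p) (fpoly c n p)) (of_nat j) = poly f (of_nat j)" by blast
    define s where "s = (\<Sum>p<k. smult (a p) (fpoly c n p))"
    define b where "b = a(k := (poly f (of_nat k) - poly s (of_nat k)) / poly (fpoly c n k) (of_nat k))"
    have s: "(\<Sum>p<Suc k. smult (b p) (fpoly c n p)) = s + smult (b k) (fpoly c n k)"
      by (simp add: s_def b_def)
    have nz: "poly (fpoly c n k) (of_nat k) \<noteq> 0" by (simp add: poly_fpoly[OF c])
    have "poly (s + smult (b k) (fpoly c n k)) (of_nat j) = poly f (of_nat j)" if "j < Suc k" for j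
    proof (cases "j = k")
      case True
      then show ?thesis using nz by (simp add: b_def)
    next
      case False
      then have "j < k" using that by simp
      then show ?thesis using a[of j] by (simp add: s_def[symmetric] poly_fpoly[OF c])
    qed
    then show ?case unfolding s[symmetric] by blast
  qed simp
  then obtain a where a: "\<And>j. j < Suc n \<Longrightarrow>
      poly (\<Sum>p<Suc n. smult (a p) (fpoly c n p)) (of_nat j) = poly f (of_nat j)" by blast
  have "f = (\<Sum>p<Suc n. smult (a p) (fpoly c n p))"
  proof (rule polys_eqI[OF f])
    have "degree (smult (a p) (fpoly c n p)) \<le> n" if "p < Suc n" for p
      using degree_fpoly[of p n c] degree_smult_le[of "a p" "fpoly c n p"] that by linarith
    then show "(\<Sum>p<Suc n. smult (a p) (fpoly c n p)) \<in> polys n"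
      unfolding polys_def mem_Collect_eq by (intro degree_sum_le) auto
  qed (use a in auto)
  then show ?thesis by (metis lessThan_Suc_atMost)
qed

lemma shifted_neg_power:
  "(1 - fps_X) ^ (N + 1) * Abs_fps (\<lambda>m. if m < p then 0 else of_nat ((m - p + N) choose N)) =
     (fps_X ^ p :: complex fps)"
proof -
  have i: "inverse ((1 - fps_X) ^ (N + 1)) = (Abs_fps (\<lambda>k. of_nat ((k + N) choose N)) :: complex fps)"
    using one_minus_const_fps_X_neg_power'[of "N + 1" "1::complex"]
    by (simp add: add.commute binomial_symmetric[of N])
  have shift: "Abs_fps (\<lambda>m. if m < p then 0 else of_nat ((m - p + N) choose N)) =
      (fps_X ^ p * inverse ((1 - fps_X) ^ (N + 1)) :: complex fps)"
    unfolding i by (simp add: fps_eq_iff fps_X_power_mult_nth)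
  have "(1 - fps_X) ^ (N + 1) * inverse ((1 - fps_X) ^ (N + 1)) = (1 :: complex fps)"
    by (subst mult.commute, rule inverse_mult_eq_1) (simp add: fps_power_zeroth)
  then show ?thesis unfolding shift by (metis mult.left_commute mult.right_neutral)
qed

lemma operator_generic:
  fixes K :: "complex fps" and w :: "nat \<Rightarrow> complex" and mn :: "nat \<Rightarrow> complex poly"
  assumes c: "c \<ge> 1" and K: "K \<noteq> 0" and w: "\<And>m. w m \<noteq> 0" and d: "d \<noteq> 0"
    and key: "\<And>p. p \<le> n \<Longrightarrow>
      K * Abs_fps (\<lambda>m. poly (fpoly c n p) (of_nat m) * w m) = fps_const d * fps_X ^ p"
    and mn: "\<And>p. mn p = (THE q. fps_of_poly q = K * Abs_fps (\<lambda>m. of_nat m ^ p * w m))"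
    and T: "\<And>f. T f = (\<Sum>p\<le>n. smult (coeff f p) (mn p))"
  shows "p \<le> n \<Longrightarrow> fps_of_poly (mn p) = K * Abs_fps (\<lambda>m. of_nat m ^ p * w m)"
    and "bij_betw T (polys n) (polys n)"
    and "p \<le> n \<Longrightarrow> T (fpoly c n p) = monom d p"
proof -
  define E where "E f = K * Abs_fps (\<lambda>m. poly f (of_nat m) * w m)" for f
  have E_sum: "E (\<Sum>p\<le>n. smult (a p) (h p)) = (\<Sum>p\<le>n. fps_const (a p) * E (h p))" for a h
  proof -
    have "Abs_fps (\<lambda>m. poly (\<Sum>p\<le>n. smult (a p) (h p)) (of_nat m) * w m) =
        (\<Sum>p\<le>n. fps_const (a p) * Abs_fps (\<lambda>m. poly (h p) (of_nat m) * w m))"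
      by (simp add: fps_eq_iff fps_sum_nth poly_sum sum_distrib_right mult.assoc)
    then show ?thesis unfolding E_def by (simp add: sum_distrib_left mult.left_commute)
  qed
  have E_poly: "\<exists>q\<in>polys n. fps_of_poly q = E f" if f: "f \<in> polys n" for f
  proof -
    obtain a where a: "f = (\<Sum>p\<le>n. smult (a p) (fpoly c n p))" using fpoly_span[OF c f] by blast
    have "E f = (\<Sum>p\<le>n. fps_const (a p) * (fps_const d * fps_X ^ p))"
      unfolding a E_sum by (rule sum.cong) (use key in \<open>auto simp: E_def\<close>)
    also have "\<dots> = fps_of_poly (\<Sum>p\<le>n. monom (a p * d) p)"
      by (simp add: fps_of_poly_sum fps_of_poly_monom mult.assoc flip: fps_const_mult)
    finally have "fps_of_poly (\<Sum>p\<le>n. monom (a p * d) p) = E f" by simp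
    moreover have "(\<Sum>p\<le>n. monom (a p * d) p) \<in> polys n"
      unfolding polys_def by (auto intro!: degree_sum_le order.trans[OF degree_monom_le])
    ultimately show ?thesis by blast
  qed
  have mn_E: "mn p \<in> polys n \<and> fps_of_poly (mn p) = E (monom 1 p)" if p: "p \<le> n" for p
  proof -
    have "monom 1 p \<in> polys n" using p by (simp add: polys_def degree_monom_eq)
    then obtain q where q: "q \<in> polys n" "fps_of_poly q = E (monom 1 p)" using E_poly by blast
    have "mn p = (THE q. fps_of_poly q = E (monom 1 p))"
      unfolding mn E_def by (simp add: poly_monom)
    also have "\<dots> = q" using q(2) by (intro the_equality) (auto simp flip: fps_of_poly_eq_iff)
    finally show ?thesis using q by simp
  qed
  then show "p \<le> n \<Longrightarrow> fps_of_poly (mn p) = K * Abs_fps (\<lambda>m. of_nat m ^ p * w m)"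
    by (simp add: E_def poly_monom)
  have T_E: "fps_of_poly (T f) = E f" if f: "f \<in> polys n" for f
  proof -
    have "f = (\<Sum>p\<le>n. monom (coeff f p) p)"
      using f by (intro poly_as_sum_of_monoms'[symmetric]) (simp add: polys_def)
    also have "\<dots> = (\<Sum>p\<le>n. smult (coeff f p) (monom 1 p))" by (simp add: smult_monom)
    finally have "E f = E (\<Sum>p\<le>n. smult (coeff f p) (monom 1 p))" by simp
    also have "\<dots> = (\<Sum>p\<le>n. fps_const (coeff f p) * fps_of_poly (mn p))"
      unfolding E_sum by (rule sum.cong) (use mn_E in auto)
    also have "\<dots> = fps_of_poly (T f)"
      unfolding T by (simp add: fps_of_poly_sum fps_of_poly_smult)
    finally show ?thesis by simp
  qed
  show Tf: "T (fpoly c n p) = monom d p" if p: "p \<le> n" for p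
  proof -
    have "fps_of_poly (T (fpoly c n p)) = fps_of_poly (monom d p)"
      using T_E[of "fpoly c n p"] degree_fpoly[OF p, of c] key[OF p]
      by (simp add: polys_def E_def fps_of_poly_monom)
    then show ?thesis by (simp add: fps_of_poly_eq_iff)
  qed
  have T_in: "T f \<in> polys n" for f
    unfolding T polys_def using mn_E
    by (auto intro!: degree_sum_le order.trans[OF degree_smult_le] simp: polys_def)
  have inj: "inj_on T (polys n)"
  proof (rule inj_onI)
    fix f g assume fg: "f \<in> polys n" "g \<in> polys n" "T f = T g"
    then have "E f = E g" using T_E by metis
    then have "Abs_fps (\<lambda>m. poly f (of_nat m) * w m) = Abs_fps (\<lambda>m. poly g (of_nat m) * w m)"
      using K by (simp add: E_def)
    then have "poly f (of_nat m) = poly g (of_nat m)" for m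
      using w by (auto simp: fps_eq_iff)
    then show "f = g" using polys_eqI fg by blast
  qed
  have surj: "g \<in> T ` polys n" if g: "g \<in> polys n" for g
  proof
    let ?f = "\<Sum>p\<le>n. smult (coeff g p / d) (fpoly c n p)"
    show f: "?f \<in> polys n" unfolding polys_def using degree_fpoly
      by (auto intro!: degree_sum_le order.trans[OF degree_smult_le])
    have "fps_of_poly (T ?f) = (\<Sum>p\<le>n. fps_const (coeff g p / d) * E (fpoly c n p))"
      unfolding T_E[OF f] E_sum ..
    also have "\<dots> = (\<Sum>p\<le>n. fps_of_poly (monom (coeff g p) p))"
      by (rule sum.cong) (use key d in \<open>auto simp: E_def fps_of_poly_monom simp flip: mult.assoc\<close>)
    also have "\<dots> = fps_of_poly g"
      using g poly_as_sum_of_monoms'[of g n] by (simp add: polys_def flip: fps_of_poly_sum)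
    finally show "g = T ?f" by (simp add: fps_of_poly_eq_iff)
  qed
  show "bij_betw T (polys n) (polys n)"
    using inj surj T_in by (auto simp: bij_betw_def)
qed

lemma U_key:
  assumes "p \<le> n"
  shows "fps_const (1 / fact n) * (1 - fps_X) ^ (n + 1) *
    Abs_fps (\<lambda>m. poly (fpoly 1 n p) (of_nat m) * 1) = fps_const 1 * fps_X ^ p"
proof -
  have "poly (fpoly 1 n p) (of_nat m) * 1 =
      fact n * (if m < p then 0 else of_nat ((m - p + n) choose n))" for m
    using assms by (auto simp: poly_fpoly binomial_fact of_nat_diff)
  then have "Abs_fps (\<lambda>m. poly (fpoly 1 n p) (of_nat m) * 1) =
      fps_const (fact n) * Abs_fps (\<lambda>m. if m < p then 0 else of_nat ((m - p + n) choose n))"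
    by (simp add: fps_eq_iff)
  moreover have "fps_const (1 / fact n) * fps_const (fact n :: complex) = 1" by simp
  ultimately show ?thesis using shifted_neg_power[of n p]
    by (metis (no_types, lifting) fps_const_1_eq_1 mult.assoc mult.left_commute mult_1)
qed

lemma F_key:
  assumes "p \<le> n"
  shows "(1 - fps_X) ^ (2 * n + 1) *
    Abs_fps (\<lambda>m. poly (fpoly (n + 1) n p) (of_nat m) * of_nat ((m + n) choose n)) =
    fps_const (fact (2 * n) / fact n) * fps_X ^ p"
proof -
  have "poly (fpoly (n + 1) n p) (of_nat m) * of_nat ((m + n) choose n) =
      fact (2 * n) / fact n * (if m < p then 0 else of_nat ((m - p + 2 * n) choose (2 * n)))" for m
  proof (cases "m < p")
    case False
    have "m + n + (n - p) = m - p + 2 * n" using assms False by simp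
    then have "m + (n + 1) + (n - p) - 1 = m - p + 2 * n" by simp
    then show ?thesis using False
      by (simp add: poly_fpoly binomial_fact del: mult_2)
  qed (simp add: poly_fpoly)
  then have "Abs_fps (\<lambda>m. poly (fpoly (n + 1) n p) (of_nat m) * of_nat ((m + n) choose n)) =
      fps_const (fact (2 * n) / fact n) *
        Abs_fps (\<lambda>m. if m < p then 0 else of_nat ((m - p + 2 * n) choose (2 * n)))"
    by (simp add: fps_eq_iff)
  then show ?thesis using shifted_neg_power[of "2 * n" p]
    by (metis (no_types, lifting) mult.left_commute)
qed

lemma one_minus_fps_X_power_nonzero: "(1 - fps_X) ^ k \<noteq> (0 :: complex fps)"
proof -
  have "((1 - fps_X) ^ k :: complex fps) $ 0 \<noteq> 0" by (simp add: fps_power_zeroth)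
  then show ?thesis by force
qed

context
  fixes n :: nat
begin

lemma U_K_nonzero: "fps_const (1 / fact n) * (1 - fps_X) ^ (n + 1) \<noteq> (0 :: complex fps)"
  using one_minus_fps_X_power_nonzero[of "n + 1"] by simp

lemma U_mono_alt: "U_mono n p = (THE q. fps_of_poly q =
    fps_const (1 / fact n) * (1 - fps_X) ^ (n + 1) * Abs_fps (\<lambda>m. of_nat m ^ p * 1))"
  by (simp add: U_mono_def U_series_def)

lemmas U_generic = operator_generic[where c = 1 and n = n and w = "\<lambda>_. 1" and d = 1
    and mn = "U_mono n" and T = "U_op n",
    OF le_refl U_K_nonzero one_neq_zero one_neq_zero U_key U_mono_alt U_op_def]

lemma F_w_nonzero: "of_nat ((m + n) choose n) \<noteq> (0 :: complex)"
  by simp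

lemma F_d_nonzero: "fact (2 * n) / fact n \<noteq> (0 :: complex)"
  by simp

lemma F_mono_alt: "F_mono n p = (THE q. fps_of_poly q =
    (1 - fps_X) ^ (2 * n + 1) * Abs_fps (\<lambda>m. of_nat m ^ p * of_nat ((m + n) choose n)))"
  by (simp add: F_mono_def F_series_def)

lemmas F_generic = operator_generic[where c = "n + 1" and n = n
    and mn = "F_mono n" and T = "F_op n",
    OF le_add2 one_minus_fps_X_power_nonzero F_w_nonzero F_d_nonzero F_key F_mono_alt F_op_def]

end

lemma U_mono: "p \<le> n \<Longrightarrow> fps_of_poly (U_mono n p) = U_series n p"
  using U_generic(1)[where n = n and p = p] by (simp add: U_series_def)

lemma F_mono: "p \<le> n \<Longrightarrow> fps_of_poly (F_mono n p) = F_series n p"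
  using F_generic(1)[where n = n and p = p] by (simp add: F_series_def)

lemma U_op_fpoly: "p \<le> n \<Longrightarrow> U_op n (fpoly 1 n p) = monom 1 p"
  by (rule U_generic(3))

lemma F_op_fpoly: "p \<le> n \<Longrightarrow> F_op n (fpoly (n + 1) n p) = monom (fact (2 * n) / fact n) p"
  by (rule F_generic(3))

lemma bij_betw_U_op: "bij_betw (U_op n) (polys n) (polys n)"
  by (rule U_generic(2))

lemma bij_betw_F_op: "bij_betw (F_op n) (polys n) (polys n)"
  by (rule F_generic(2))

lemma bij_betw_S_op: "bij_betw (S_op n) (polys n) (polys n)"
  unfolding S_op_def U_inv_def
  by (rule bij_betw_trans[OF bij_betw_the_inv_into[OF bij_betw_U_op] bij_betw_F_op])

end

theory Submission
  imports Defs
begin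

text \<open>
  Applying \<open>F\<^sub>n\<^sup>-\<^sup>1\<close> and then \<open>U\<^sub>n\<close> turns the claim into the expansion of \<open>(x)\<^sub>p [x + n + 1]\<^bsub>n-p\<^esub>\<close> in the
  basis \<open>(x)\<^sub>m [x + 1]\<^bsub>n-m\<^esub>\<close>. Both sides have degree at most \<open>n\<close>, so it suffices to compare them at
  \<open>n + 1\<close> points. At \<open>0, \<dots>, p - 1\<close> every term vanishes, and at \<open>p\<close> only the term \<open>m = p\<close> survives.
  At the remaining roots \<open>-(n + 1 + s)\<close>, \<open>s < n - p\<close>, of the left-hand side, the right-hand side is a
  \<open>2n\<close>-th finite difference of a polynomial of degree \<open>2n - 1\<close>, hence zero.
\<close>

section \<open>Finite differences of polynomials\<close>

lemma degree_diff_shift_less: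
  fixes q :: "'a::idom poly"
  assumes "degree q > 0"
  shows "degree (q - pcompose q [:1, 1:]) < degree q"
proof (rule degree_lessI)
  show "q - pcompose q [:1, 1:] \<noteq> 0 \<or> degree q > 0"
    using assms by simp
  have "coeff (pcompose q [:1, 1:]) (degree q) = lead_coeff q"
    using lead_coeff_comp[of "[:1, 1:]" q] by (simp add: degree_pcompose)
  moreover have "coeff (pcompose q [:1, 1:]) k = 0" if "k > degree q" for k
    using that by (simp add: coeff_eq_0 degree_pcompose)
  ultimately show "\<forall>k\<ge>degree q. coeff (q - pcompose q [:1, 1:]) k = 0"
    by (metis coeff_diff coeff_eq_0 diff_self le_neq_implies_less)
qed

text \<open>Pascal's rule splits the binomial; shifting the index in one half turns the sum of order
  M + 1 into one of order M over differences of \<open>f\<close>.\<close>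

lemma alternating_binomial_sum_Suc:
  fixes f :: "nat \<Rightarrow> 'a::comm_ring_1"
  shows "(\<Sum>k\<le>Suc M. (-1) ^ k * of_nat (Suc M choose k) * f k) =
    (\<Sum>k\<le>M. (-1) ^ k * of_nat (M choose k) * (f k - f (Suc k)))"
proof -
  have "(\<Sum>k\<le>Suc M. (-1) ^ k * of_nat (Suc M choose k) * f k) =
      f 0 + (\<Sum>k\<le>M. (-1) ^ Suc k * of_nat (M choose Suc k) * f (Suc k))
          - (\<Sum>k\<le>M. (-1) ^ k * of_nat (M choose k) * f (Suc k))"
    by (subst sum.atMost_Suc_shift)
       (simp add: algebra_simps sum.distrib sum_negf sum_subtractf)
  also have "f 0 + (\<Sum>k\<le>M. (-1) ^ Suc k * of_nat (M choose Suc k) * f (Suc k)) =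
      (\<Sum>k\<le>Suc M. (-1) ^ k * of_nat (M choose k) * f k)"
    by (subst sum.atMost_Suc_shift) simp
  also have "\<dots> = (\<Sum>k\<le>M. (-1) ^ k * of_nat (M choose k) * f k)"
    by (simp add: binomial_eq_0)
  finally show ?thesis by (simp add: algebra_simps sum_subtractf)
qed

lemma alternating_binomial_sum_poly:
  fixes q :: "'a::idom poly"
  assumes "degree q < M"
  shows "(\<Sum>k\<le>M. (-1) ^ k * of_nat (M choose k) * poly q (of_nat k)) = 0"
  using assms
proof (induction M arbitrary: q)
  case (Suc M)
  have eq: "(\<Sum>k\<le>Suc M. (-1) ^ k * of_nat (Suc M choose k) * poly q (of_nat k)) =
      (\<Sum>k\<le>M. (-1) ^ k * of_nat (M choose k) * poly (q - pcompose q [:1, 1:]) (of_nat k))"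
    unfolding alternating_binomial_sum_Suc by (simp add: poly_pcompose)
  show ?case
  proof (cases "degree q = 0")
    \<comment> \<open>A constant has degree 0 and so has its difference, so the induction hypothesis
      cannot be used when M = 0; here the difference itself is zero.\<close>
    case True
    then obtain c where "q = [:c:]" by (auto elim: degree_eq_zeroE)
    then show ?thesis unfolding eq by simp
  next
    case False
    then have "degree (q - pcompose q [:1, 1:]) < M"
      using degree_diff_shift_less[of q] Suc.prems by linarith
    then show ?thesis unfolding eq by (rule Suc.IH)
  qed
qed simp

section \<open>Coefficients and basis values as products of linear factors\<close>

text \<open>Up to the sign, this exhibits the coefficient as a polynomial in \<open>i\<close> of
  degree n - 1, as the finite difference argument requires. For n = 0 it would fail at every i >
  0.\<close>

lemma gbinomial_minus_of_nat:
  assumes "n > 0"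
  shows "(- of_nat n gchoose i :: complex) =
    (-1) ^ i / fact (n - 1) * (\<Prod>t<n - 1. of_nat (1 + t) + of_nat i)"
proof -
  have "of_nat n + of_nat i - 1 = (of_nat (n + i - 1) :: complex)"
    using assms by (simp add: of_nat_diff)
  then have "(- of_nat n gchoose i :: complex) = (-1) ^ i * of_nat (n + i - 1 choose i)"
    by (simp add: gbinomial_minus binomial_gbinomial)
  also have "\<dots> = (-1) ^ i * (fact (n + i - 1) / (fact i * fact (n - 1)))"
    using assms by (subst binomial_fact) (auto simp: algebra_simps)
  also have "n + i - 1 = i + 1 + (n - 1) - 1"
    using assms by simp
  finally show ?thesis by (subst rising_of_nat) simp_all
qed

text \<open>All n factors are negative, and their absolute values are the consecutive integers from
  s + m + 1 to s + m + n. The value is thus a polynomial in \<open>m\<close> of degree n.\<close>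

lemma poly_fpoly_1_neg:
  assumes "m \<le> n"
  shows "poly (fpoly 1 n m) (- of_nat (n + 1 + s)) =
    (-1) ^ n * (\<Prod>t<n. of_nat (1 + t) + of_nat (s + m))"
proof -
  have "poly (fpoly 1 n m) (- of_nat (n + 1 + s)) =
      (\<Prod>i<m. -1 * of_nat (n + 1 + s + i)) * (\<Prod>i<n - m. -1 * (of_nat (n + s) - of_nat i))"
    unfolding fpoly_def poly_mult poly_prod
    by (intro arg_cong2[where f = "(*)"] prod.cong) (auto simp: algebra_simps)
  \<comment> \<open>The summand \<open>of_nat 0\<close> gives the product the shape of
    \<open>rising_of_nat\<close>.\<close>
  also have "\<dots> = ((-1) ^ m * (\<Prod>i<m. of_nat (n + s + 1 + i) + of_nat 0)) *
      ((-1) ^ (n - m) * (\<Prod>i<n - m. of_nat (n + s) - of_nat i))"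
    by (simp only: prod.distrib prod_constant card_lessThan) (simp add: algebra_simps)
  also have "\<dots> = (-1) ^ (m + (n - m)) *
      (fact (n + s + m) / fact (n + s) * (fact (n + s) / fact (n + s - (n - m))))"
    by (subst rising_of_nat, simp, subst falling_of_nat) (simp add: power_add)
  also have "\<dots> = (-1) ^ n * (fact (s + m + n) / fact (s + m))"
    using assms by (simp add: algebra_simps)
  finally show ?thesis by (subst rising_of_nat) (simp_all add: add_ac)
qed

section \<open>Expansion in the basis \<open>fpoly 1 n m\<close>\<close>

lemma expansion_root:
  assumes "s < n - p"
  shows "(\<Sum>m = p..n. (- of_nat n gchoose (m - p)) * (of_nat (2 * n) gchoose (n - m)) *
    poly (fpoly 1 n m) (- of_nat (n + 1 + s))) = 0"
proof -
  \<comment> \<open>The products from \<open>gbinomial_minus_of_nat\<close> and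
    \<open>poly_fpoly_1_neg\<close>, rewritten in k = n - m.\<close>
  define q :: "complex poly" where
    "q = (\<Prod>t<n - 1. [:of_nat (n - p + 1 + t), -1:]) * (\<Prod>t<n. [:of_nat (s + n + 1 + t), -1:])"
  have "degree (\<Prod>t<n - 1. [:of_nat (n - p + 1 + t), -1:] :: complex poly) = n - 1"
    by (subst degree_prod_eq_sum_degree) auto
  moreover have "degree (\<Prod>t<n. [:of_nat (s + n + 1 + t), -1:] :: complex poly) = n"
    by (subst degree_prod_eq_sum_degree) auto
  ultimately have "degree q < 2 * n"
    unfolding q_def using assms by (intro le_less_trans[OF degree_mult_le]) simp
  then have total: "(\<Sum>k\<le>2 * n. (-1) ^ k * of_nat (2 * n choose k) * poly q (of_nat k)) = 0"
    by (rule alternating_binomial_sum_poly)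
  \<comment> \<open>The roots of \<open>q\<close> run from n - p + 1 to 2n - p - 1 and from s + n +
    1 to s + 2n. As s < n - p, they leave no gap up to 2n, so the sum over k <= n - p equals the
    full difference.\<close>
  have q_0: "poly q (of_nat k) = 0" if k: "n - p < k" "k \<le> 2 * n" for k
  proof (cases "k < n - p + n")
    case True
    then have "k - (n - p + 1) < n - 1" "k = n - p + 1 + (k - (n - p + 1))"
      using k by linarith+
    then have "(\<Prod>t<n - 1. of_nat (n - p + 1 + t) - of_nat k :: complex) = 0"
      by (metis (no_types, lifting) diff_self finite_lessThan lessThan_iff prod_zero_iff)
    then show ?thesis by (simp add: q_def poly_prod)
  next
    case False
    then have "k - (s + n + 1) < n" "k = s + n + 1 + (k - (s + n + 1))"
      using k assms by linarith+
    then have "(\<Prod>t<n. of_nat (s + n + 1 + t) - of_nat k :: complex) = 0"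
      by (metis (no_types, lifting) diff_self finite_lessThan lessThan_iff prod_zero_iff)
    then show ?thesis by (simp add: q_def poly_prod)
  qed
  have "(\<Sum>k\<le>n - p. (-1) ^ k * of_nat (2 * n choose k) * poly q (of_nat k)) =
      (\<Sum>k\<le>2 * n. (-1) ^ k * of_nat (2 * n choose k) * poly q (of_nat k))"
    by (rule sum.mono_neutral_left) (auto simp: q_0)
  then have partial: "(\<Sum>k\<le>n - p. (-1) ^ k * of_nat (2 * n choose k) * poly q (of_nat k)) = 0"
    using total by simp
  have "(\<Sum>m = p..n. (- of_nat n gchoose (m - p)) * (of_nat (2 * n) gchoose (n - m)) *
      poly (fpoly 1 n m) (- of_nat (n + 1 + s))) =
      (\<Sum>k\<le>n - p. (-1) ^ (n - p) / fact (n - 1) * (-1) ^ n *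
        ((-1) ^ k * of_nat (2 * n choose k) * poly q (of_nat k)))"
  proof (rule sum.reindex_bij_witness[where i = "\<lambda>k. n - k" and j = "\<lambda>m. n - m"])
    fix m assume m: "m \<in> {p..n}"
    have 1: "(\<Prod>t<n - 1. of_nat (1 + t) + of_nat (m - p) :: complex) =
        (\<Prod>t<n - 1. of_nat (n - p + 1 + t) - of_nat (n - m))"
      using m by (intro prod.cong) (auto simp: of_nat_diff)
    have 2: "(\<Prod>t<n. of_nat (1 + t) + of_nat (s + m) :: complex) =
        (\<Prod>t<n. of_nat (s + n + 1 + t) - of_nat (n - m))"
      using m by (intro prod.cong) (auto simp: of_nat_diff)
    \<comment> \<open>The exponents differ by 2(n - m); this isolates the alternating sign in k = n
      - m.\<close>
    have 3: "(-1 :: complex) ^ (m - p) = (-1) ^ (n - p) * (-1) ^ (n - m)"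
    proof -
      have "(-1 :: complex) ^ (n - p + (n - m)) = (-1) ^ (m - p + 2 * (n - m))"
        using m by (intro arg_cong[where f = "(^) (-1)"]) auto
      then show ?thesis unfolding power_add power_mult by simp
    qed
    have 4: "poly q (of_nat (n - m)) =
        (\<Prod>t<n - 1. of_nat (1 + t) + of_nat (m - p)) * (\<Prod>t<n. of_nat (1 + t) + of_nat (s + m))"
      unfolding 1 2 by (simp add: q_def poly_prod)
    have 5: "n > 0" "m \<le> n" using assms m by auto
    have 6: "a / f * b * (c * d * (u * v)) = a * c / f * u * d * (b * v)" for a b c d f u v :: complex
      by simp
    show "(-1) ^ (n - p) / fact (n - 1) * (-1) ^ n *
        ((-1) ^ (n - m) * of_nat (2 * n choose (n - m)) * poly q (of_nat (n - m))) =
        (- of_nat n gchoose (m - p)) * (of_nat (2 * n) gchoose (n - m)) *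
        poly (fpoly 1 n m) (- of_nat (n + 1 + s))"
      unfolding gbinomial_minus_of_nat[OF 5(1)] poly_fpoly_1_neg[OF 5(2)] 3 4
        binomial_gbinomial[symmetric]
      by (rule 6)
  qed (use assms in auto)
  also have "\<dots> = 0"
    unfolding sum_distrib_left[symmetric] partial by simp
  finally show ?thesis .
qed

text \<open>The point x = p fixes the scalar: the left side is p! (2n)! / (n + p)! there, and the
  term m = p is binom(2n, n - p) n!.\<close>

lemma fpoly_expansion:
  assumes "p \<le> n"
  shows "fpoly (n + 1) n p = smult (fact p * fact (n - p) / fact n)
    (\<Sum>m = p..n. smult ((- of_nat n gchoose (m - p)) * (of_nat (2 * n) gchoose (n - m))) (fpoly 1 n m))"
    (is "_ = ?R")
proof -
  define A :: "complex set" where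
    "A = of_nat ` {..p} \<union> (\<lambda>s. - of_nat (n + 1 + s)) ` {..<n - p}"
  have "of_nat i \<noteq> (- of_nat (n + 1 + s) :: complex)" for i s
  proof
    assume "of_nat i = (- of_nat (n + 1 + s) :: complex)"
    then have "of_nat (i + (n + 1 + s)) = (0 :: complex)" by simp
    then show False by (simp only: of_nat_eq_0_iff)
  qed
  then have "card A = card (of_nat ` {..p} :: complex set) +
      card ((\<lambda>s. - of_nat (n + 1 + s) :: complex) ` {..<n - p})"
    unfolding A_def by (intro card_Un_disjoint) auto
  also have "\<dots> = Suc p + (n - p)"
    by (subst (1 2) card_image) (auto simp: inj_on_def)
  finally have card: "card A = Suc n" using assms by simp
  have "?R \<in> polys n"
    unfolding polys_def mem_Collect_eq using degree_fpoly
    by (intro order.trans[OF degree_smult_le] degree_sum_le) auto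
  moreover have "fpoly (n + 1) n p \<in> polys n"
    using assms by (simp add: polys_def degree_fpoly)
  moreover have "poly (fpoly (n + 1) n p) x = poly ?R x" if x: "x \<in> A" for x
  proof -
    consider j where "j \<le> p" "x = of_nat j" | s where "s < n - p" "x = - of_nat (n + 1 + s)"
      using x unfolding A_def by blast
    then show ?thesis
    proof cases
      case 1
      have "poly ?R x = fact p * fact (n - p) / fact n *
          (\<Sum>m = p..n. (- of_nat n gchoose (m - p)) * (of_nat (2 * n) gchoose (n - m)) *
            poly (fpoly 1 n m) x)"
        by (simp add: poly_sum)
      also have "(\<Sum>m = p..n. (- of_nat n gchoose (m - p)) * (of_nat (2 * n) gchoose (n - m)) *
            poly (fpoly 1 n m) x) =
          (\<Sum>m\<in>{p}. (- of_nat n gchoose (m - p)) * (of_nat (2 * n) gchoose (n - m)) *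
            poly (fpoly 1 n m) x)"
        \<comment> \<open>For m > p the falling factor of \<open>fpoly 1 n m\<close> vanishes at j
          <= p.\<close>
        using 1 assms by (intro sum.mono_neutral_right) (auto simp: poly_fpoly)
      finally have R: "poly ?R x = fact p * fact (n - p) / fact n *
          (of_nat (2 * n choose (n - p)) * poly (fpoly 1 n p) x)"
        by (simp add: binomial_gbinomial)
      show ?thesis
      proof (cases "j = p")
        case True
        have "2 * n - (n - p) = p + n" "p + (n + 1) + (n - p) - 1 = 2 * n"
          using assms by auto
        then show ?thesis unfolding R using True 1 assms
          by (simp add: poly_fpoly binomial_fact) (simp add: mult_2 add_ac)
      next
        case False
        then show ?thesis unfolding R using 1 by (simp add: poly_fpoly)
      qed
    next
      case 2
      have "poly (fpoly (n + 1) n p) x = 0"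
        using 2 by (auto simp: fpoly_def poly_prod prod_zero_iff intro!: bexI[of _ s])
      moreover have "poly ?R x = 0"
        using expansion_root[OF 2(1)] unfolding 2(2) by (simp add: poly_sum)
      ultimately show ?thesis by simp
    qed
  qed
  ultimately show ?thesis
    using card by (intro poly_eqI_degree[where A = A]) (auto simp: polys_def)
qed

section \<open>Linearity of the operators and the formula for the inverse\<close>

lemma U_op_smult: "U_op n (smult c f) = smult c (U_op n f)"
  by (rule poly_eqI) (simp add: U_op_def coeff_sum sum_distrib_left mult.assoc)

lemma U_op_sum: "U_op n (\<Sum>i\<in>I. f i) = (\<Sum>i\<in>I. U_op n (f i))"
  unfolding U_op_def coeff_sum smult_sum by (rule sum.swap)

lemma F_op_smult: "F_op n (smult c f) = smult c (F_op n f)"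
  by (rule poly_eqI) (simp add: F_op_def coeff_sum sum_distrib_left mult.assoc)

theorem theorem4p3:
  fixes n p :: nat
  assumes "p \<le> n"
  shows "S_inv n (monom 1 p) =
    smult (fact p * fact (n - p) / fact (2 * n))
      (\<Sum>m = p..n. monom ((- of_nat n gchoose (m - p)) * (of_nat (2 * n) gchoose (n - m))) m)"
    (is "_ = ?f")
proof -
  \<comment> \<open>By \<open>F_op_fpoly\<close>, this is the preimage of x^p under
    \<open>F_op n\<close>; its image under \<open>U_op n\<close> is the claimed polynomial.\<close>
  define g where "g = smult (fact n / fact (2 * n)) (fpoly (n + 1) n p)"
  have g: "g \<in> polys n"
    using degree_fpoly[OF assms] by (auto simp: polys_def g_def)
  have "U_op n g = smult (fact p * fact (n - p) / fact (2 * n))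
      (\<Sum>m = p..n. smult ((- of_nat n gchoose (m - p)) * (of_nat (2 * n) gchoose (n - m)))
        (U_op n (fpoly 1 n m)))"
    unfolding g_def fpoly_expansion[OF assms] U_op_smult U_op_sum by simp
  also have "\<dots> = ?f"
    by (intro arg_cong[where f = "smult _"] sum.cong) (simp_all only: U_op_fpoly smult_monom mult_1_right atLeastAtMost_iff)
  finally have Ug: "U_op n g = ?f" .
  have "S_op n ?f = F_op n g"
    unfolding S_op_def U_inv_def Ug[symmetric]
    by (simp add: the_inv_into_f_f[OF bij_betw_imp_inj_on[OF bij_betw_U_op] g])
  also have "\<dots> = monom 1 p"
    unfolding g_def F_op_smult F_op_fpoly[OF assms] by (simp add: smult_monom)
  finally have "S_op n ?f = monom 1 p" .
  \<comment> \<open>\<open>the_inv_into\<close> requires the preimage to lie in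
    \<open>polys n\<close>; this holds because \<open>U_op n\<close> maps that set to
    itself.\<close>
  moreover have "?f \<in> polys n"
    using bij_betwE[OF bij_betw_U_op] g Ug by metis
  ultimately show ?thesis
    unfolding S_inv_def by (intro the_inv_into_f_eq[OF bij_betw_imp_inj_on[OF bij_betw_S_op]])
qed

end
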